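(* Let $\mathcal{S}$ be a set of atoms of the monoid $\mathcal{L}$ of Left dead ends such that, for every $G\in\mathcal{S}$, every option of $G$ that is both good and racing is prime-factorisable. Then every Left dead end that is equal to a finite sum of elements of $\mathcal{S}$ is uniquely factorisable.
   Context: All games are short partizan combinatorial game forms; $G+H$ is the disjunctive sum; $\cong$ denotes identity of forms. Play is misère (a player unable to move wins). Misère outcome classes are ordered $\mathscr L>\mathscr P>\mathscr R$ and $\mathscr L>\mathscr N>\mathscr R$; $G\geq H$ means that for every game $X$ the misère outcome of $G+X$ is $\geq$ that of $H+X$, $G=H$ means $G\ge H$ and $H\ge G$, and $G>H$ means $G\ge H$ and $G\ne H$. A Left dead end is a game no subposition of which (including itself) has a Left option; its options are its Right options. An option $G'$ of $G$ is good if there is no option $G''$ of $G$ with $G'>G''$. A run of length $k$ of $G$ is a sequence $(G_0,\dots,G_k)$ with $G_0\cong G$ and $G_{i+1}$ an option of $G_i$; it is terminal if $G_k\cong0=\{\cdot\mid\cdot\}$; $\operatorname{race}(G)$ is the minimum length of a terminal run; a racing option of $G$ is an option $G'$ with $\operatorname{race}(G')=\operatorname{race}(G)-1$. The Left dead ends up to equality form a commutative monoid $\mathcal L$ under $+$ with identity $0$. An atom is a Left dead end $A\neq0$ such that $A=X+Y$ with Left dead ends $X,Y$ implies $X=0$ or $Y=0$. A factorisation of $G$ is an expression $G=A_1+\dots+A_k$ ($k\ge0$) with atoms $A_i$, up to reordering and replacing atoms by equal ones; $G$ is uniquely factorisable if it has exactly one factorisation. $P\mid X$ means $X=P+Y$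 for some Left dead end $Y$; a prime is a Left dead end $P\neq0$ such that $P\mid X+Y$ implies $P\mid X$ or $P\mid Y$; prime-factorisable means having a factorisation consisting only of primes (the empty sum included). *)

theory Defs
  imports "HOL-Library.FSet" "HOL-Library.Multiset"
begin

section \<open>Short partizan game forms\<close>

text \<open>Options are kept in finite sets, so the HOL equality \<open>G = H\<close> on this type is the
  identity of forms \<open>G \<cong> H\<close>.  Equality of games is the relation \<open>G \<approx> H\<close> below.\<close>

datatype game = Game (left_opts: "game fset") (right_opts: "game fset")

definition opts :: "game \<Rightarrow> game fset" where
  "opts G = left_opts G |\<union>| right_opts G"

definition opt_rel :: "(game \<times> game) set" where
  "opt_rel = {(G', G). G' |\<in>| opts G}"

lemma wf_opt_rel: "wf opt_rel"
proof (rule wfUNIVI)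
  fix P :: "game \<Rightarrow> bool" and G
  assume IH: "\<forall>G. (\<forall>G'. (G', G) \<in> opt_rel \<longrightarrow> P G') \<longrightarrow> P G"
  show "P G"
    by (induction G) (rule IH[rule_format], auto simp: opt_rel_def opts_def)
qed

lemma opt_rel_left [simp, intro]: "G' |\<in>| left_opts G \<Longrightarrow> (G', G) \<in> opt_rel"
  and opt_rel_right [simp, intro]: "G' |\<in>| right_opts G \<Longrightarrow> (G', G) \<in> opt_rel"
  by (auto simp: opt_rel_def opts_def)

instantiation game :: zero
begin

definition zero_game :: game where
  "0 = Game {||} {||}"

instance ..

end

instantiation game :: plus
begin

function plus_game :: "game \<Rightarrow> game \<Rightarrow> game" where
  "G + H = Game
     ((\<lambda>G'. G' + H) |`| left_opts G |\<union>| (\<lambda>H'. G + H') |`| left_opts H)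
     ((\<lambda>G'. G' + H) |`| right_opts G |\<union>| (\<lambda>H'. G + H') |`| right_opts H)"
  by pat_completeness auto
termination
  by (relation "inv_image (opt_rel <*lex*> opt_rel) id") (auto intro!: wf_opt_rel)

instance ..

end

declare plus_game.simps [simp del]

lemma left_opts_plus:
  "left_opts (G + H) = (\<lambda>G'. G' + H) |`| left_opts G |\<union>| (\<lambda>H'. G + H') |`| left_opts H"
  by (subst plus_game.simps) simp

lemma right_opts_plus:
  "right_opts (G + H) = (\<lambda>G'. G' + H) |`| right_opts G |\<union>| (\<lambda>H'. G + H') |`| right_opts H"
  by (subst plus_game.simps) simp

instance game :: comm_monoid_add
proof
  fix G H K :: game
  show "G + H + K = G + (H + K)"
  proof (induction "(G, H, K)" arbitrary: G H K
      rule: wf_induct_rule[OF wf_lex_prod[OF wf_opt_rel wf_lex_prod[OF wf_opt_rel wf_opt_rel]]])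
    case 1
    show ?case
      by (rule game.expand)
        (auto simp: left_opts_plus right_opts_plus fimage_funion fset.map_comp comp_def
          funion_assoc 1 intro!: arg_cong2[where f = "(|\<union>|)"] fset.map_cong0)
  qed
  show "G + H = H + G"
  proof (induction "(G, H)" arbitrary: G H
      rule: wf_induct_rule[OF wf_lex_prod[OF wf_opt_rel wf_opt_rel]])
    case 1
    have "(\<lambda>G'. G' + H) |`| left_opts G = (\<lambda>G'. H + G') |`| left_opts G"
      "(\<lambda>G'. G' + H) |`| right_opts G = (\<lambda>G'. H + G') |`| right_opts G"
      "(\<lambda>H'. G + H') |`| left_opts H = (\<lambda>H'. H' + G) |`| left_opts H"
      "(\<lambda>H'. G + H') |`| right_opts H = (\<lambda>H'. H' + G) |`| right_opts H"
      by (auto intro!: fset.map_cong0 1)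
    then show ?case
      by (intro game.expand) (simp add: left_opts_plus right_opts_plus funion_commute)
  qed
  show "0 + G = G"
  proof (induction G rule: wf_induct_rule[OF wf_opt_rel])
    case (1 G)
    have "(\<lambda>H'. 0 + H') |`| left_opts G = id |`| left_opts G"
      "(\<lambda>H'. 0 + H') |`| right_opts G = id |`| right_opts G"
      by (intro fset.map_cong0; simp add: 1)+
    then show ?case
      by (intro game.expand) (simp add: left_opts_plus right_opts_plus zero_game_def fset.map_id)
  qed
qed


section \<open>Misere outcomes and the order on games\<close>

text \<open>\<open>wins_first True G\<close>: Left, moving first on \<open>G\<close>, wins; \<open>wins_first False G\<close>: the same for
  Right.  A player who cannot move wins.\<close>

function wins_first :: "bool \<Rightarrow> game \<Rightarrow> bool" where
  "wins_first left G =
    (let Opts = fset (if left then left_opts G else right_opts G)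
     in Opts = {} \<or> (\<exists>G'\<in>Opts. \<not> wins_first (\<not> left) G'))"
  by pat_completeness auto
termination
  by (relation "inv_image opt_rel snd") (auto intro!: wf_opt_rel split: if_splits)

declare wins_first.simps [simp del]

datatype outcome = Outcome_L | Outcome_P | Outcome_N | Outcome_R

instantiation outcome :: order
begin

definition less_eq_outcome :: "outcome \<Rightarrow> outcome \<Rightarrow> bool" where
  "x \<le> y \<longleftrightarrow> x = y \<or> x = Outcome_R \<or> y = Outcome_L"

definition less_outcome :: "outcome \<Rightarrow> outcome \<Rightarrow> bool" where
  "x < y \<longleftrightarrow> x \<le> y \<and> x \<noteq> (y :: outcome)"

instance
  by standard (auto simp: less_eq_outcome_def less_outcome_def)

end

definition outcome :: "game \<Rightarrow> outcome" where
  "outcome G =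
    (if wins_first True G
     then (if wins_first False G then Outcome_N else Outcome_L)
     else (if wins_first False G then Outcome_R else Outcome_P))"

definition game_ge :: "game \<Rightarrow> game \<Rightarrow> bool" (infix "\<succeq>" 50) where
  "G \<succeq> H \<longleftrightarrow> (\<forall>X. outcome (G + X) \<ge> outcome (H + X))"

definition game_eq :: "game \<Rightarrow> game \<Rightarrow> bool" (infix "\<approx>" 50) where
  "G \<approx> H \<longleftrightarrow> G \<succeq> H \<and> H \<succeq> G"

definition game_gt :: "game \<Rightarrow> game \<Rightarrow> bool" (infix "\<succ>" 50) where
  "G \<succ> H \<longleftrightarrow> G \<succeq> H \<and> \<not> G \<approx> H"


section \<open>Left dead ends, good options and racing options\<close>

definition subposition :: "game \<Rightarrow> game \<Rightarrow> bool" where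
  "subposition H G \<longleftrightarrow> (H, G) \<in> opt_rel\<^sup>*"

definition left_dead_end :: "game \<Rightarrow> bool" where
  "left_dead_end G \<longleftrightarrow> (\<forall>H. subposition H G \<longrightarrow> left_opts H = {||})"

text \<open>Goodness is only meant for Left dead ends, where \<open>opts G = right_opts G\<close>.\<close>

definition good_opt :: "game \<Rightarrow> game \<Rightarrow> bool" where
  "good_opt G' G \<longleftrightarrow> G' |\<in>| opts G \<and> \<not> (\<exists>G''. G'' |\<in>| opts G \<and> G' \<succ> G'')"

text \<open>A run \<open>(G\<^sub>0, \<dots>, G\<^sub>k)\<close> of length \<open>k\<close> is a list with \<open>k + 1\<close> entries.\<close>

definition is_run :: "game \<Rightarrow> nat \<Rightarrow> game list \<Rightarrow> bool" where
  "is_run G k Gs \<longleftrightarrow> length Gs = Suc k \<and> Gs ! 0 = G \<and> (\<forall>i<k. Gs ! Suc i |\<in>| opts (Gs ! i))"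

definition is_terminal_run :: "game \<Rightarrow> nat \<Rightarrow> game list \<Rightarrow> bool" where
  "is_terminal_run G k Gs \<longleftrightarrow> is_run G k Gs \<and> Gs ! k = 0"

definition race :: "game \<Rightarrow> nat" where
  "race G = (LEAST k. \<exists>Gs. is_terminal_run G k Gs)"

definition racing_opt :: "game \<Rightarrow> game \<Rightarrow> bool" where
  "racing_opt G' G \<longleftrightarrow> G' |\<in>| opts G \<and> int (race G') = int (race G) - 1"


section \<open>Factorisation in the monoid of Left dead ends\<close>

text \<open>Elements of the monoid are represented by forms, with \<open>\<approx>\<close> in place of equality.\<close>

definition is_atom :: "game \<Rightarrow> bool" where
  "is_atom A \<longleftrightarrow> left_dead_end A \<and> \<not> A \<approx> 0 \<and>
    (\<forall>X Y. left_dead_end X \<longrightarrow> left_dead_end Y \<longrightarrow> A \<approx> X + Y \<longrightarrow> X \<approx> 0 \<or> Y \<approx> 0)"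

definition is_factorisation :: "game multiset \<Rightarrow> game \<Rightarrow> bool" where
  "is_factorisation As G \<longleftrightarrow> (\<forall>A\<in>#As. is_atom A) \<and> G \<approx> \<Sum>\<^sub># As"

text \<open>\<open>rel_mset (\<approx>) As Bs\<close>: some bijective matching of the entries of \<open>As\<close> and \<open>Bs\<close> pairs
  equal games, i.e. the factorisations agree up to reordering and replacing atoms by equal ones.\<close>

definition uniquely_factorisable :: "game \<Rightarrow> bool" where
  "uniquely_factorisable G \<longleftrightarrow>
    (\<exists>As. is_factorisation As G \<and> (\<forall>Bs. is_factorisation Bs G \<longrightarrow> rel_mset (\<approx>) As Bs))"

definition divides :: "game \<Rightarrow> game \<Rightarrow> bool" where
  "divides P X \<longleftrightarrow> (\<exists>Y. left_dead_end Y \<and> X \<approx> P + Y)"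

definition is_prime :: "game \<Rightarrow> bool" where
  "is_prime P \<longleftrightarrow> left_dead_end P \<and> \<not> P \<approx> 0 \<and>
    (\<forall>X Y. left_dead_end X \<longrightarrow> left_dead_end Y \<longrightarrow> divides P (X + Y) \<longrightarrow> divides P X \<or> divides P Y)"

definition prime_factorisable :: "game \<Rightarrow> bool" where
  "prime_factorisable G \<longleftrightarrow> (\<exists>Ps. is_factorisation Ps G \<and> (\<forall>P\<in>#Ps. is_prime P))"

end

theory Submission
  imports Defs
begin

(* On Left dead ends the misere order is structural: G >= H iff every (Right) option of G
   dominates some option of H, and 0 is comparable only to itself.  Hence terminal runs transfer
   from G to H, so race is monotone (and additive), and addition is cancellative.

   For unique factorisation, induct on the race over sums of elements of S and primes.  Given
   A_1 + ... + A_k = B_1 + ... + B_m, it is enough to find an atom common to both sides, and a prime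
   on the left is always one.  Otherwise a good racing option of the sum has the form
   A_i' + (other A's) with A_i' good and racing, hence a sum of primes, and it equals some
   B_j' + (other B's).  By induction each remaining B is one of the remaining A's or one of the
   primes in A_i'; in the latter case that prime divides A_1 + ... + A_k and so is one of the A's. *)

section \<open>Left dead ends\<close>

lemma left_dead_end_iff:
  "left_dead_end G \<longleftrightarrow> left_opts G = {||} \<and> (\<forall>G'. G' |\<in>| right_opts G \<longrightarrow> left_dead_end G')"
proof
  assume G: "left_dead_end G"
  then show "left_opts G = {||} \<and> (\<forall>G'. G' |\<in>| right_opts G \<longrightarrow> left_dead_end G')"
    unfolding left_dead_end_def subposition_def
    by (meson opt_rel_right rtrancl.simps)
next
  assume G: "left_opts G = {||} \<and> (\<forall>G'. G' |\<in>| right_opts G \<longrightarrow> left_dead_end G')"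
  show "left_dead_end G"
    unfolding left_dead_end_def subposition_def
  proof (intro allI impI)
    fix H assume "(H, G) \<in> opt_rel\<^sup>*"
    then show "left_opts H = {||}"
    proof (cases rule: rtranclE)
      case base
      then show ?thesis using G by simp
    next
      case (step y)
      then have "left_dead_end y" using G by (auto simp: opt_rel_def opts_def)
      then show ?thesis using step by (auto simp: left_dead_end_def subposition_def)
    qed
  qed
qed

lemma left_opts_dead [simp]: "left_dead_end G \<Longrightarrow> left_opts G = {||}"
  and left_dead_end_right_opt: "left_dead_end G \<Longrightarrow> G' |\<in>| right_opts G \<Longrightarrow> left_dead_end G'"
  using left_dead_end_iff by blast+

lemma opts_dead: "left_dead_end G \<Longrightarrow> opts G = right_opts G"
  by (simp add: opts_def)

lemma zero_opts [simp]: "left_opts 0 = {||}" "right_opts 0 = {||}" "opts 0 = {||}"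
  by (simp_all add: zero_game_def opts_def)

lemma opts_empty_iff: "opts G = {||} \<longleftrightarrow> G = 0"
  by (cases G) (auto simp: zero_game_def opts_def)

lemma right_opts_empty_iff: "left_dead_end G \<Longrightarrow> right_opts G = {||} \<longleftrightarrow> G = 0"
  by (metis opts_dead opts_empty_iff)

lemma left_dead_end_0 [simp]: "left_dead_end 0"
  by (subst left_dead_end_iff) simp

lemma left_dead_end_induct [consumes 1, case_names dead]:
  assumes "left_dead_end G"
    and step: "\<And>G. left_dead_end G \<Longrightarrow> (\<And>G'. G' |\<in>| right_opts G \<Longrightarrow> P G') \<Longrightarrow> P G"
  shows "P G"
  using assms(1)
proof (induction G rule: wf_induct_rule[OF wf_opt_rel])
  case (1 G)
  show ?case
    by (rule step) (auto intro!: 1 left_dead_end_right_opt[OF 1(2)])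
qed

lemma left_dead_end_plus [simp]:
  assumes "left_dead_end G" "left_dead_end H"
  shows "left_dead_end (G + H)"
  using assms
proof (induction G arbitrary: H rule: left_dead_end_induct)
  case (dead G)
  show ?case using dead(3)
  proof (induction H rule: left_dead_end_induct)
    case (dead H)
    then show ?case
      using \<open>left_dead_end G\<close> \<open>\<And>G' H. G' |\<in>| right_opts G \<Longrightarrow> left_dead_end H \<Longrightarrow> left_dead_end (G' + H)\<close>
      by (subst left_dead_end_iff) (auto simp: left_opts_plus right_opts_plus)
  qed
qed

lemma left_dead_end_sum_mset: "\<forall>A\<in>#As. left_dead_end A \<Longrightarrow> left_dead_end (\<Sum>\<^sub># As)"
  by (induction As) auto

lemma right_opts_sum_mset:
  "H |\<in>| right_opts (\<Sum>\<^sub># As) \<Longrightarrow> \<exists>A A'. A \<in># As \<and> A' |\<in>| right_opts A \<and> H = A' + \<Sum>\<^sub># (As - {#A#})"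
proof (induction As arbitrary: H)
  case empty
  then show ?case by simp
next
  case (add a As)
  then consider a' where "a' |\<in>| right_opts a" "H = a' + \<Sum>\<^sub># As"
    | H' where "H' |\<in>| right_opts (\<Sum>\<^sub># As)" "H = a + H'"
    by (auto simp: right_opts_plus)
  then show ?case
  proof cases
    case 1
    then show ?thesis by (intro exI[of _ a] exI[of _ a']) simp
  next
    case 2
    then obtain A A' where A: "A \<in># As" "A' |\<in>| right_opts A" "H' = A' + \<Sum>\<^sub># (As - {#A#})"
      using add.IH by blast
    then have "H = A' + \<Sum>\<^sub># (add_mset a As - {#A#})"
      using 2 by (simp add: add_ac)
    then show ?thesis using A by (intro exI[of _ A] exI[of _ A']) simp
  qed
qed


section \<open>The misere order\<close>

lemma wins_first_True: "wins_first True G \<longleftrightarrow>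
    left_opts G = {||} \<or> (\<exists>G'. G' |\<in>| left_opts G \<and> \<not> wins_first False G')"
  by (subst wins_first.simps) (auto simp: Let_def)

lemma wins_first_False: "wins_first False G \<longleftrightarrow>
    right_opts G = {||} \<or> (\<exists>G'. G' |\<in>| right_opts G \<and> \<not> wins_first True G')"
  by (subst wins_first.simps) (auto simp: Let_def)

text \<open>The four outcomes are the pairs of answers to who wins when Left starts and who wins
  when Right starts. Their order is the product order, with the second answer reversed because a win
  for Right is bad for Left.\<close>

lemma outcome_ge_iff: "outcome H \<le> outcome G \<longleftrightarrow>
    (wins_first True H \<longrightarrow> wins_first True G) \<and> (wins_first False G \<longrightarrow> wins_first False H)"
  by (auto simp: outcome_def less_eq_outcome_def)

lemma game_ge_iff: "G \<succeq> H \<longleftrightarrow>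
    (\<forall>X. (wins_first True (H + X) \<longrightarrow> wins_first True (G + X)) \<and>
         (wins_first False (G + X) \<longrightarrow> wins_first False (H + X)))"
  by (simp add: game_ge_def outcome_ge_iff)

section \<open>Preorder and congruence properties\<close>

lemma game_ge_refl [simp]: "G \<succeq> G"
  by (simp add: game_ge_iff)

lemma game_ge_trans [trans]: "G \<succeq> H \<Longrightarrow> H \<succeq> K \<Longrightarrow> G \<succeq> K"
  by (auto simp: game_ge_iff)

lemma game_ge_plus: "G \<succeq> H \<Longrightarrow> G + K \<succeq> H + K"
  by (simp add: game_ge_def add.assoc)

lemma game_eq_refl [simp]: "G \<approx> G"
  by (simp add: game_eq_def)

lemma game_eq_sym: "G \<approx> H \<Longrightarrow> H \<approx> G"
  by (simp add: game_eq_def)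

lemma game_eq_trans [trans]: "G \<approx> H \<Longrightarrow> H \<approx> K \<Longrightarrow> G \<approx> K"
  by (auto simp: game_eq_def intro: game_ge_trans)

lemma game_eq_plus:
  assumes "G \<approx> G'" "H \<approx> H'"
  shows "G + H \<approx> G' + H'"
proof -
  have "G + H \<approx> G' + H" using assms by (simp add: game_eq_def game_ge_plus)
  also have "G' + H \<approx> G' + H'"
    using assms game_ge_plus[of _ _ G'] by (simp add: game_eq_def add.commute[of G'])
  finally show ?thesis .
qed

text \<open>By induction on the test game \<open>X\<close>. Left can only move in \<open>X\<close>,
  so her moves beside \<open>H\<close> work beside \<open>G\<close>; Right's winning move to
  \<open>G'\<close> is replaced by a dominated \<open>H'\<close>. The premise \<open>zero\<close>
  covers the case where Right wins on \<open>G + X\<close> by having no move: he must then have none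
  on \<open>H + X\<close> either.\<close>

lemma dead_game_geI:
  assumes G: "left_dead_end G" and H: "left_dead_end H"
    and zero: "G = 0 \<Longrightarrow> H = 0"
    and opts: "\<And>G'. G' |\<in>| right_opts G \<Longrightarrow> \<exists>H'. H' |\<in>| right_opts H \<and> G' \<succeq> H'"
  shows "G \<succeq> H"
  unfolding game_ge_iff
proof
  fix X
  show "(wins_first True (H + X) \<longrightarrow> wins_first True (G + X)) \<and>
        (wins_first False (G + X) \<longrightarrow> wins_first False (H + X))"
  proof (induction X rule: wf_induct_rule[OF wf_opt_rel])
    case (1 X)
    have "wins_first True (G + X)" if H_wins: "wins_first True (H + X)"
    proof (cases "left_opts X = {||}")
      case True
      then show ?thesis
        using G by (simp add: wins_first_True left_opts_plus)
    next
      case False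
      then obtain X' where "X' |\<in>| left_opts X" "\<not> wins_first False (H + X')"
        using H_wins H by (subst (asm) wins_first_True) (auto simp: left_opts_plus)
      then show ?thesis
        using 1[of X'] by (subst wins_first_True) (auto simp: left_opts_plus)
    qed
    moreover have "wins_first False (H + X)" if G_wins: "wins_first False (G + X)"
    proof -
      consider "right_opts (G + X) = {||}"
        | X' where "X' |\<in>| right_opts X" "\<not> wins_first True (G + X')"
        | G' where "G' |\<in>| right_opts G" "\<not> wins_first True (G' + X)"
        using G_wins by (subst (asm) wins_first_False) (auto simp: right_opts_plus)
      then show ?thesis
      proof cases
        case 1
        then have "G = 0" "right_opts X = {||}"
          using right_opts_empty_iff[OF G] by (auto simp: right_opts_plus)
        then show ?thesis using zero by (subst wins_first_False) simp
      next
        case 2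
        then show ?thesis
          using 1[of X'] by (subst wins_first_False) (auto simp: right_opts_plus)
      next
        case 3
        then obtain H' where "H' |\<in>| right_opts H" "G' \<succeq> H'" using opts by blast
        then show ?thesis
          using 3 by (subst wins_first_False) (auto simp: right_opts_plus game_ge_iff)
      qed
    qed
    ultimately show ?case by blast
  qed
qed

text \<open>A game \<open>Y\<close> that separates \<open>G\<close> and \<open>H\<close> with Left moving first turns into the game
  \<open>{\<cdot> | Y}\<close> that separates them with Right moving first: any Right move in \<open>H\<close> leaves Left
  without a move, and so winning.\<close>

lemma dead_not_game_ge_witness:
  assumes G: "left_dead_end G" and H: "left_dead_end H" and "\<not> G \<succeq> H"
  shows "\<exists>Z. wins_first False (G + Z) \<and> \<not> wins_first False (H + Z)"
proof (rule ccontr)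
  assume *: "\<not> ?thesis"
  \<comment> \<open>Under the assumption no game separates the two with Right moving first, so a
    separating game does so with Left moving first.\<close>
  then obtain Y where Y: "wins_first True (H + Y)" "\<not> wins_first True (G + Y)"
    using assms(3) by (auto simp: game_ge_iff)
  define Z where "Z = Game {||} {|Y|}"
  have "wins_first False (G + Z)"
    using Y by (subst wins_first_False) (auto simp: right_opts_plus Z_def)
  moreover have "wins_first True (H' + Z)" if "H' |\<in>| right_opts H" for H'
    using left_dead_end_right_opt[OF H that]
    by (subst wins_first_True) (simp add: left_opts_plus Z_def)
  then have "\<not> wins_first False (H + Z)"
    using Y by (subst wins_first_False) (auto simp: right_opts_plus Z_def)
  ultimately show False using * by blast
qed

text \<open>Supplies test games for \<open>zero_game_geD\<close>. If \<open>Z\<close> works for an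
  option \<open>G'\<close>, then the game whose only option is a Left option to \<open>Z\<close>
  works for \<open>G\<close>: Right moves to \<open>G'\<close> and Left is forced to move to
  \<open>Z\<close>.\<close>

lemma dead_right_wins_first:
  assumes "left_dead_end G"
  shows "\<exists>Z. wins_first False (G + Z)"
  using assms
proof (induction G rule: left_dead_end_induct)
  case (dead G)
  show ?case
  proof (cases "right_opts G = {||}")
    case True
    then show ?thesis
      by (intro exI[of _ 0]) (simp add: wins_first_False)
  next
    case False
    then obtain G' where G': "G' |\<in>| right_opts G" by auto
    then obtain Z where Z: "wins_first False (G' + Z)" using dead by blast
    have "\<not> wins_first True (G' + Game {|Z|} {||})"
      using Z left_dead_end_right_opt[OF dead(1) G']
      by (subst wins_first_True) (auto simp: left_opts_plus)
    then have "wins_first False (G + Game {|Z|} {||})"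
      using G' by (subst wins_first_False) (auto simp: right_opts_plus)
    then show ?thesis by blast
  qed
qed

text \<open>Tested against 0: Right moving first on 0 wins, whereas any move of his in a nonzero
  Left dead end leaves Left to move with no option, which wins for her.\<close>

lemma game_ge_zeroD:
  assumes G: "left_dead_end G" and H: "left_dead_end H" and ge: "G \<succeq> H" and "G = 0"
  shows "H = 0"
proof -
  have "wins_first False (0::game)" by (subst wins_first_False) simp
  then have "wins_first False H" using ge \<open>G = 0\<close> by (metis game_ge_iff add.right_neutral)
  moreover have "wins_first True H'" if "H' |\<in>| right_opts H" for H'
    using left_dead_end_right_opt[OF H that] by (subst wins_first_True) simp
  ultimately have "right_opts H = {||}" by (subst (asm) wins_first_False) auto
  then show ?thesis using right_opts_empty_iff[OF H] by simp
qed

lemma zero_game_geD: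
  assumes G: "left_dead_end G" and ge: "G \<succeq> 0"
  shows "G = 0"
proof (rule ccontr)
  assume "G \<noteq> 0"
  then obtain G' where G': "G' |\<in>| right_opts G" using right_opts_empty_iff[OF G] by auto
  have dead: "left_dead_end G'" using G G' left_dead_end_right_opt by blast
  then obtain Z where Z: "wins_first False (G' + Z)" using dead_right_wins_first by blast
  \<comment> \<open>Beside 0, Right's only move is to 0, where Left cannot move and wins. Beside
    \<open>G\<close>, Right moves to \<open>G'\<close> and Left's only reply is to
    \<open>G' + Z\<close>, which Right wins.\<close>
  define X where "X = Game {|Z|} {|0|}"
  have "\<not> wins_first True (G' + X)"
    using Z dead by (subst wins_first_True) (auto simp: left_opts_plus X_def)
  then have "wins_first False (G + X)"
    using G' by (subst wins_first_False) (auto simp: right_opts_plus)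
  moreover have "wins_first True (0::game)" by (subst wins_first_True) simp
  then have "\<not> wins_first False (0 + X)" by (subst wins_first_False) (simp add: X_def)
  ultimately show False using ge game_ge_iff by blast
qed

text \<open>Converse of \<open>dead_game_geI\<close>. If \<open>G'\<close> dominated no option of
  \<open>H\<close>, every \<open>H'\<close> would have its own separating game; a test game offering
  all of these to Left separates \<open>G\<close> from \<open>H\<close>.\<close>

lemma game_ge_optD:
  assumes G: "left_dead_end G" and H: "left_dead_end H" and ge: "G \<succeq> H"
    and G': "G' |\<in>| right_opts G"
  shows "\<exists>H'. H' |\<in>| right_opts H \<and> G' \<succeq> H'"
proof (rule ccontr)
  assume no: "\<not> ?thesis"
  have dead: "left_dead_end G'" using G G' left_dead_end_right_opt by blast
  have "\<exists>Z. wins_first False (G' + Z) \<and> \<not> wins_first False (H' + Z)"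
    if "H' |\<in>| right_opts H" for H'
    using no that dead_not_game_ge_witness[OF dead] left_dead_end_right_opt[OF H] by blast
  then obtain Z where Z: "\<And>H'. H' |\<in>| right_opts H \<Longrightarrow>
      wins_first False (G' + Z H') \<and> \<not> wins_first False (H' + Z H')" by metis
  \<comment> \<open>Otherwise \<open>X\<close> below would have no Left option, and Left would win
    on \<open>G' + X\<close> for lack of a move.\<close>
  have "right_opts H \<noteq> {||}"
  proof
    assume "right_opts H = {||}"
    then have "H = 0" using right_opts_empty_iff[OF H] by simp
    then have "G = 0" using zero_game_geD[OF G] ge by simp
    then show False using G' by simp
  qed
  \<comment> \<open>Right has no move in \<open>X\<close>, so in \<open>H + X\<close> he must choose
    some \<open>H'\<close>, and Left answers with \<open>Z H'\<close>. After Right's move to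
    \<open>G' + X\<close>, each choice of Left loses.\<close>
  define X where "X = Game (Z |`| right_opts H) {||}"
  have "\<not> wins_first True (G' + X)"
    using Z dead \<open>right_opts H \<noteq> {||}\<close>
    by (subst wins_first_True) (auto simp: left_opts_plus X_def)
  then have "wins_first False (G + X)"
    using G' by (subst wins_first_False) (auto simp: right_opts_plus)
  moreover have "wins_first True (H' + X)" if "H' |\<in>| right_opts H" for H'
    using Z[OF that] that by (subst wins_first_True) (auto simp: left_opts_plus X_def)
  then have "\<not> wins_first False (H + X)"
    using \<open>right_opts H \<noteq> {||}\<close>
    by (subst wins_first_False) (auto simp: right_opts_plus X_def)
  ultimately show False using ge game_ge_iff by blast
qed

text \<open>Lets equality to 0 be traded for identity of forms.\<close>

lemma dead_eq_zero_iff: "left_dead_end G \<Longrightarrow> G \<approx> 0 \<longleftrightarrow> G = 0"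
  using zero_game_geD game_eq_def by auto


section \<open>Terminal runs and the race\<close>

text \<open>Hides the list of positions, so that runs can be handled by recursion on their
  length.\<close>

definition has_terminal_run :: "game \<Rightarrow> nat \<Rightarrow> bool" where
  "has_terminal_run G k \<longleftrightarrow> (\<exists>Gs. is_terminal_run G k Gs)"

lemma has_terminal_run_0 [simp]: "has_terminal_run G 0 \<longleftrightarrow> G = 0"
  by (auto simp: has_terminal_run_def is_terminal_run_def is_run_def intro: exI[of _ "[G]"])

lemma has_terminal_run_Suc:
  "has_terminal_run G (Suc k) \<longleftrightarrow> (\<exists>G'. G' |\<in>| opts G \<and> has_terminal_run G' k)"
proof
  assume "has_terminal_run G (Suc k)"
  then obtain Gs where Gs: "length Gs = Suc (Suc k)" "Gs ! 0 = G"
      "\<forall>i<Suc k. Gs ! Suc i |\<in>| opts (Gs ! i)" "Gs ! Suc k = 0"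
    by (auto simp: has_terminal_run_def is_terminal_run_def is_run_def)
  then have "is_terminal_run (Gs ! Suc 0) k (tl Gs)"
    by (auto simp: is_terminal_run_def is_run_def nth_tl)
  moreover have "Gs ! Suc 0 |\<in>| opts G" using Gs by auto
  ultimately show "\<exists>G'. G' |\<in>| opts G \<and> has_terminal_run G' k"
    by (auto simp: has_terminal_run_def)
next
  assume "\<exists>G'. G' |\<in>| opts G \<and> has_terminal_run G' k"
  then obtain G' Gs where "G' |\<in>| opts G" "is_terminal_run G' k Gs"
    by (auto simp: has_terminal_run_def)
  then have "is_terminal_run G (Suc k) (G # Gs)"
    by (auto simp: is_terminal_run_def is_run_def nth_Cons split: nat.splits)
  then show "has_terminal_run G (Suc k)"
    by (auto simp: has_terminal_run_def)
qed

lemma has_terminal_run_zero_iff: "has_terminal_run 0 k \<longleftrightarrow> k = 0"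
  by (cases k) (auto simp: has_terminal_run_Suc)

lemma ex_terminal_run: "\<exists>k. has_terminal_run G k"
proof (induction G rule: wf_induct_rule[OF wf_opt_rel])
  case (1 G)
  show ?case
  proof (cases "G = 0")
    case True
    then show ?thesis using has_terminal_run_0 by blast
  next
    case False
    then obtain G' where "G' |\<in>| opts G" using opts_empty_iff by auto
    moreover from this obtain k where "has_terminal_run G' k" using 1[of G'] by (auto simp: opt_rel_def)
    ultimately show ?thesis using has_terminal_run_Suc by blast
  qed
qed

section \<open>Terminal runs of sums and of comparable games\<close>

lemma opts_plus: "opts (G + H) = (\<lambda>G'. G' + H) |`| opts G |\<union>| (\<lambda>H'. G + H') |`| opts H"
  by (auto simp: opts_def left_opts_plus right_opts_plus)

lemma game_plus_eq_0_iff: "G + H = 0 \<longleftrightarrow> G = 0 \<and> H = (0::game)"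
  by (auto simp: opts_plus simp flip: opts_empty_iff)

lemma has_terminal_run_plusI:
  "has_terminal_run G j \<Longrightarrow> has_terminal_run H k \<Longrightarrow> has_terminal_run (G + H) (j + k)"
  by (induction j arbitrary: G) (auto simp: has_terminal_run_Suc opts_plus)

text \<open>Each move of the run takes place in one summand, so the run is an interleaving of a run
  of \<open>G\<close> and a run of \<open>H\<close>.\<close>

lemma has_terminal_run_plusD:
  "has_terminal_run (G + H) n \<Longrightarrow> \<exists>j k. n = j + k \<and> has_terminal_run G j \<and> has_terminal_run H k"
proof (induction n arbitrary: G H)
  case 0
  then show ?case by (simp add: game_plus_eq_0_iff)
next
  case (Suc n)
  then consider G' where "G' |\<in>| opts G" "has_terminal_run (G' + H) n"
    | H' where "H' |\<in>| opts H" "has_terminal_run (G + H') n"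
    by (auto simp: has_terminal_run_Suc opts_plus)
  then show ?case
  proof cases
    case 1
    then obtain j k where "n = j + k" "has_terminal_run G' j" "has_terminal_run H k"
      using Suc.IH by blast
    then show ?thesis
      using 1 by (intro exI[of _ "Suc j"] exI[of _ k]) (auto simp: has_terminal_run_Suc)
  next
    case 2
    then obtain j k where "n = j + k" "has_terminal_run G j" "has_terminal_run H' k"
      using Suc.IH by blast
    then show ?thesis
      using 2 by (intro exI[of _ j] exI[of _ "Suc k"]) (auto simp: has_terminal_run_Suc)
  qed
qed

text \<open>The run is copied move by move: \<open>game_ge_optD\<close> provides a dominated option
  at each move, and \<open>game_ge_zeroD\<close> makes the copy end at 0.\<close>

lemma has_terminal_run_mono:
  "has_terminal_run G k \<Longrightarrow> left_dead_end G \<Longrightarrow> left_dead_end H \<Longrightarrow> G \<succeq> H \<Longrightarrow> has_terminal_run H k"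
proof (induction k arbitrary: G H)
  case 0
  then show ?case using game_ge_zeroD by auto
next
  case (Suc k)
  then obtain G' where G': "G' |\<in>| right_opts G" "has_terminal_run G' k"
    by (auto simp: has_terminal_run_Suc opts_dead)
  then obtain H' where H': "H' |\<in>| right_opts H" "G' \<succeq> H'"
    using game_ge_optD Suc.prems by blast
  then have "has_terminal_run H' k"
    using Suc.IH G' Suc.prems left_dead_end_right_opt by blast
  then show ?case using H' Suc.prems by (auto simp: has_terminal_run_Suc opts_dead)
qed

section \<open>The race as an additive and monotone invariant\<close>

lemma race_eq: "race G = (LEAST k. has_terminal_run G k)"
  by (simp add: race_def has_terminal_run_def)

lemma has_terminal_run_race: "has_terminal_run G (race G)"
  using ex_terminal_run LeastI_ex unfolding race_eq by metis

lemma race_le: "has_terminal_run G k \<Longrightarrow> race G \<le> k"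
  by (simp add: race_eq Least_le)

lemma race_plus: "race (G + H) = race G + race H"
proof (rule antisym)
  show "race (G + H) \<le> race G + race H"
    by (intro race_le has_terminal_run_plusI has_terminal_run_race)
  obtain j k where "race (G + H) = j + k" "has_terminal_run G j" "has_terminal_run H k"
    using has_terminal_run_plusD[OF has_terminal_run_race] by blast
  then show "race G + race H \<le> race (G + H)" by (simp add: race_le add_mono)
qed

lemma race_zero [simp]: "race 0 = 0"
  using has_terminal_run_race[of 0] by (simp add: has_terminal_run_zero_iff)

lemma race_eq_0_iff: "race G = 0 \<longleftrightarrow> G = 0"
  using has_terminal_run_race[of G] by (metis has_terminal_run_0 race_zero)

lemma race_mono: "left_dead_end G \<Longrightarrow> left_dead_end H \<Longrightarrow> G \<succeq> H \<Longrightarrow> race H \<le> race G"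
  by (meson has_terminal_run_mono has_terminal_run_race race_le)

lemma race_cong: "left_dead_end G \<Longrightarrow> left_dead_end H \<Longrightarrow> G \<approx> H \<Longrightarrow> race G = race H"
  by (simp add: game_eq_def race_mono antisym)

lemma race_le_Suc_race_opt: "G' |\<in>| opts G \<Longrightarrow> race G \<le> Suc (race G')"
  by (intro race_le) (use has_terminal_run_race in \<open>auto simp: has_terminal_run_Suc\<close>)

lemma ex_racing_opt:
  assumes "G \<noteq> 0"
  shows "\<exists>G'. racing_opt G' G"
proof -
  obtain k where k: "race G = Suc k" using assms race_eq_0_iff not0_implies_Suc by blast
  then obtain G' where G': "G' |\<in>| opts G" "has_terminal_run G' k"
    using has_terminal_run_race[of G] by (auto simp: has_terminal_run_Suc)
  then have "race G' = k"
    using race_le race_le_Suc_race_opt[of G' G] k by fastforce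
  then show ?thesis using G' k by (auto simp: racing_opt_def)
qed

text \<open>A smaller option has no larger race, so a minimal racing option is good.\<close>

lemma ex_good_racing_opt:
  assumes G: "left_dead_end G" and "G \<noteq> 0"
  shows "\<exists>G'. good_opt G' G \<and> racing_opt G' G"
proof -
  \<comment> \<open>Finite and, as a strict order, acyclic; hence well-founded, and the racing
    options have an \<open>R\<close>-minimal element.\<close>
  define R where "R = {(H, K). H |\<in>| opts G \<and> K |\<in>| opts G \<and> K \<succ> H}"
  have "R \<subseteq> fset (opts G) \<times> fset (opts G)" by (auto simp: R_def)
  then have "finite R" by (rule finite_subset) simp
  moreover have "trans R"
    by (auto simp: R_def trans_def game_gt_def game_eq_def intro: game_ge_trans)
  then have "acyclic R"
    by (auto simp: acyclic_def trancl_id R_def game_gt_def)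
  ultimately have "wf R" by (simp add: finite_acyclic_wf)
  moreover obtain G0 where "racing_opt G0 G" using ex_racing_opt assms by blast
  ultimately obtain G' where G': "racing_opt G' G"
      and min: "\<And>H. (H, G') \<in> R \<Longrightarrow> \<not> racing_opt H G"
    using wfE_min[of R G0 "{H. racing_opt H G}"] by auto
  have "\<not> (\<exists>G''. G'' |\<in>| opts G \<and> G' \<succ> G'')"
  proof
    assume "\<exists>G''. G'' |\<in>| opts G \<and> G' \<succ> G''"
    then obtain G'' where G'': "G'' |\<in>| opts G" "G' \<succ> G''" by blast
    have "left_dead_end G'" "left_dead_end G''"
      using G G' G'' left_dead_end_right_opt by (auto simp: racing_opt_def opts_dead)
    \<comment> \<open>No option has race below \<open>race G - 1\<close>, so a dominated option of a
      racing option is racing as well.\<close>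
    then have "race G'' \<le> race G'" using G'' race_mono by (auto simp: game_gt_def)
    then have "racing_opt G'' G"
      using G' G'' race_le_Suc_race_opt[of G'' G] by (auto simp: racing_opt_def)
    moreover have "(G'', G') \<in> R" using G' G'' by (auto simp: R_def racing_opt_def)
    ultimately show False using min by blast
  qed
  then show ?thesis using G' by (auto simp: good_opt_def racing_opt_def)
qed


section \<open>Cancellation\<close>

text \<open>By induction on \<open>G\<close>, through the options. If \<open>G' + K\<close>
  dominates some \<open>H' + K\<close>, induction applies. If instead it dominates some
  \<open>H + K1\<close> with \<open>K1\<close> an option of \<open>K\<close>, then
  \<open>swap\<close> descends through \<open>K\<close> until an option of \<open>H\<close> is
  met.\<close>

lemma game_ge_cancel:
  assumes "left_dead_end G" "left_dead_end H" "left_dead_end K" "G + K \<succeq> H + K"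
  shows "G \<succeq> H"
  using assms
proof (induction G arbitrary: H K rule: left_dead_end_induct)
  case (dead G)
  note G = dead(1) and H = dead(3) and K = dead(4)
  have zero: "H = 0" if "G = 0"
  proof -
    have "race (H + K) \<le> race (G + K)" using dead by (intro race_mono) auto
    then show ?thesis using that by (simp add: race_plus race_eq_0_iff)
  qed
  have swap: "\<exists>H'. H' |\<in>| right_opts H \<and> G' \<succeq> H'"
    if "left_dead_end K" "G' |\<in>| right_opts G" "K1 |\<in>| right_opts K" "G' + K \<succeq> H + K1" for G' K K1
    using that
  proof (induction K arbitrary: K1 rule: left_dead_end_induct)
    case (dead K)
    have dG': "left_dead_end G'" and dK1: "left_dead_end K1"
      using dead.prems dead.hyps G left_dead_end_right_opt by auto
    \<comment> \<open>Playing \<open>K\<close> to \<open>K1\<close> on the left as well restores a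
      common summand. The dominated option of \<open>H + K1\<close> either moves in
      \<open>H\<close>, and \<open>K1\<close> cancels, or moves to some \<open>K2\<close>, and the
      situation recurs with the smaller \<open>K1\<close> in place of \<open>K\<close>.\<close>
    have "G' + K1 |\<in>| right_opts (G' + K)" using dead.prems by (auto simp: right_opts_plus)
    then obtain J where J: "J |\<in>| right_opts (H + K1)" "G' + K1 \<succeq> J"
      using game_ge_optD[OF _ _ dead.prems(3)] dG' dK1 H dead.hyps by auto
    then consider H' where "H' |\<in>| right_opts H" "J = H' + K1"
      | K2 where "K2 |\<in>| right_opts K1" "J = H + K2"
      by (auto simp: right_opts_plus)
    then show ?case
    proof cases
      case 1
      then have "G' \<succeq> H'"
        using \<open>\<And>G' H K. G' |\<in>| right_opts G \<Longrightarrow> left_dead_end H \<Longrightarrow> left_dead_end K \<Longrightarrow>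
            G' + K \<succeq> H + K \<Longrightarrow> G' \<succeq> H\<close> J dK1 H dead.prems left_dead_end_right_opt by blast
      then show ?thesis using 1 by blast
    next
      case 2
      then show ?thesis using dead.IH J dead.prems by blast
    qed
  qed
  show ?case
  proof (rule dead_game_geI[OF G H])
    show "H = 0" if "G = 0" using zero that .
    fix G' assume G': "G' |\<in>| right_opts G"
    then have dG': "left_dead_end G'" using G left_dead_end_right_opt by blast
    have "G' + K |\<in>| right_opts (G + K)" using G' by (auto simp: right_opts_plus)
    then obtain J where J: "J |\<in>| right_opts (H + K)" "G' + K \<succeq> J"
      using game_ge_optD[OF _ _ dead.prems(3)] G H K by auto
    then consider H' where "H' |\<in>| right_opts H" "J = H' + K"
      | K1 where "K1 |\<in>| right_opts K" "J = H + K1"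
      by (auto simp: right_opts_plus)
    then show "\<exists>H'. H' |\<in>| right_opts H \<and> G' \<succeq> H'"
    proof cases
      case 1
      then show ?thesis using dead.IH[OF G'] J H K left_dead_end_right_opt by blast
    next
      case 2
      then show ?thesis using swap[OF K G'] J by blast
    qed
  qed
qed

lemma game_eq_cancel:
  "left_dead_end G \<Longrightarrow> left_dead_end H \<Longrightarrow> left_dead_end K \<Longrightarrow> G + K \<approx> H + K \<Longrightarrow> G \<approx> H"
  unfolding game_eq_def using game_ge_cancel by blast


section \<open>Factorisation\<close>

lemma is_atom_dead: "is_atom A \<Longrightarrow> left_dead_end A"
  by (simp add: is_atom_def)

lemma left_dead_end_sum_atoms: "\<forall>A\<in>#As. is_atom A \<Longrightarrow> left_dead_end (\<Sum>\<^sub># As)"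
  by (simp add: left_dead_end_sum_mset is_atom_dead)

lemma is_atom_nonzero: "is_atom A \<Longrightarrow> \<not> A \<approx> 0"
  by (simp add: is_atom_def)

lemma not_is_atom_0 [simp]: "\<not> is_atom 0"
  by (simp add: is_atom_def)

text \<open>By induction on the race: it is additive and positive on nonzero games, so both summands
  of a proper decomposition have smaller race.\<close>

lemma ex_factorisation:
  "left_dead_end G \<Longrightarrow> \<exists>As. is_factorisation As G"
proof (induction "race G" arbitrary: G rule: less_induct)
  case less
  consider "G \<approx> 0" | "is_atom G"
    | X Y where "left_dead_end X" "left_dead_end Y" "G \<approx> X + Y" "\<not> X \<approx> 0" "\<not> Y \<approx> 0"
    using less.prems unfolding is_atom_def by blast
  then show ?case
  proof cases
    case 1
    then show ?thesis by (intro exI[of _ "{#}"]) (simp add: is_factorisation_def)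
  next
    case 2
    then show ?thesis by (intro exI[of _ "{#G#}"]) (simp add: is_factorisation_def)
  next
    case 3
    then have "race G = race X + race Y"
      using race_cong[OF less.prems _ 3(3)] by (simp add: race_plus)
    moreover have "race X \<noteq> 0" "race Y \<noteq> 0" using 3 by (auto simp: race_eq_0_iff)
    ultimately obtain As Bs where "is_factorisation As X" "is_factorisation Bs Y"
      using less.hyps[of X] less.hyps[of Y] 3 by auto
    moreover from this have "X + Y \<approx> \<Sum>\<^sub># (As + Bs)"
      by (simp add: is_factorisation_def game_eq_plus)
    ultimately have "is_factorisation (As + Bs) G"
      using game_eq_trans[OF 3(3)] by (auto simp: is_factorisation_def)
    then show ?thesis by blast
  qed
qed

text \<open>Split off any summand \<open>b\<close>. It is not equal to 0, so the remaining sum must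
  be.\<close>

lemma atom_sum_msetD:
  assumes a: "is_atom a" and As: "\<forall>A\<in>#As. is_atom A" and eq: "a \<approx> \<Sum>\<^sub># As"
  shows "\<exists>b\<in>#As. a \<approx> b"
proof (cases As)
  case empty
  then show ?thesis using a eq by (simp add: is_atom_nonzero)
next
  case (add b Bs)
  have dead: "left_dead_end b" "left_dead_end (\<Sum>\<^sub># Bs)" "\<not> b \<approx> 0"
    using As add by (simp_all add: is_atom_nonzero is_atom_dead left_dead_end_sum_atoms)
  moreover have "a \<approx> b + \<Sum>\<^sub># Bs" using eq add by simp
  ultimately have "\<Sum>\<^sub># Bs \<approx> 0" using a unfolding is_atom_def by blast
  then have "a \<approx> b" using eq add dead dead_eq_zero_iff by auto
  then show ?thesis using add by auto
qed

lemma is_prime_dvd_atom: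
  assumes "is_prime p" "is_atom a" "divides p a"
  shows "a \<approx> p"
proof -
  obtain Y where Y: "left_dead_end Y" "a \<approx> p + Y" using assms by (auto simp: divides_def)
  then have "Y \<approx> 0" using assms unfolding is_atom_def is_prime_def by blast
  then show ?thesis using Y dead_eq_zero_iff by auto
qed

text \<open>Primality passes to one summand of the sum, and an atom divisible by a prime equals it.
  The empty sum is excluded since a divisor of 0 is 0.\<close>

lemma is_prime_dvd_sum_mset:
  assumes p: "is_prime p" and As: "\<forall>A\<in>#As. is_atom A" and dvd: "divides p (\<Sum>\<^sub># As)"
  shows "\<exists>a\<in>#As. a \<approx> p"
  using As dvd
proof (induction As)
  case empty
  then obtain Y where Y: "left_dead_end Y" "0 \<approx> p + Y" by (auto simp: divides_def)
  then have "p + Y = 0" using p dead_eq_zero_iff game_eq_sym unfolding is_prime_def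
    by (metis left_dead_end_plus)
  then show ?case using p by (auto simp: game_plus_eq_0_iff is_prime_def)
next
  case (add a As)
  have "left_dead_end a" "left_dead_end (\<Sum>\<^sub># As)"
    using add.prems by (simp_all add: is_atom_dead left_dead_end_sum_atoms)
  then have "divides p a \<or> divides p (\<Sum>\<^sub># As)"
    using p add.prems unfolding is_prime_def by auto
  then show ?case using add is_prime_dvd_atom[OF p] by auto
qed

section \<open>Divisors of sums and good options of equal games\<close>

lemma divides_sum_mset:
  assumes "\<forall>A\<in>#As. left_dead_end A" "a \<in># As"
  shows "divides a (\<Sum>\<^sub># As)"
proof -
  obtain Bs where "As = add_mset a Bs" using assms mset_add by metis
  then show ?thesis using assms unfolding divides_def
    by (intro exI[of _ "\<Sum>\<^sub># Bs"]) (auto intro!: left_dead_end_sum_mset)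
qed

lemma divides_cong: "divides p X \<Longrightarrow> X \<approx> Y \<Longrightarrow> divides p Y"
  unfolding divides_def using game_eq_sym game_eq_trans by blast

text \<open>Racing descends to the summand because the race is additive. Goodness descends because
  \<open>a' \<succ> a''\<close> would give \<open>a' + C \<succ> a'' + C\<close>, where strictness
  comes from cancellation.\<close>

lemma good_racing_opt_plus:
  assumes a: "left_dead_end a" and C: "left_dead_end C" and a': "a' |\<in>| right_opts a"
    and good: "good_opt (a' + C) (a + C)" and racing: "racing_opt (a' + C) (a + C)"
  shows "good_opt a' a \<and> racing_opt a' a"
proof
  have "a' |\<in>| opts a" using a a' by (simp add: opts_dead)
  then show "racing_opt a' a" using racing by (simp add: racing_opt_def race_plus)
  have "\<not> a' \<succ> a''" if a'': "a'' |\<in>| opts a" for a''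
  proof
    assume gt: "a' \<succ> a''"
    have dead: "left_dead_end a'" "left_dead_end a''"
      using a a' a'' left_dead_end_right_opt by (auto simp: opts_dead)
    have "a' + C \<succ> a'' + C"
      using gt game_eq_cancel[OF dead C] game_ge_plus by (auto simp: game_gt_def)
    moreover have "a'' + C |\<in>| opts (a + C)" using a'' by (auto simp: opts_plus)
    ultimately show False using good by (auto simp: good_opt_def)
  qed
  then show "good_opt a' a" using \<open>a' |\<in>| opts a\<close> by (auto simp: good_opt_def)
qed

text \<open>Pass from \<open>G'\<close> to a dominated \<open>H'\<close> and back to a dominated
  \<open>G''\<close>; goodness of \<open>G'\<close> forbids a strict descent, so all three are
  equal.\<close>

lemma good_opt_matched:
  assumes G: "left_dead_end G" and H: "left_dead_end H" and eq: "G \<approx> H" and good: "good_opt G' G"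
  shows "\<exists>H'. H' |\<in>| right_opts H \<and> G' \<approx> H'"
proof -
  have "G' |\<in>| right_opts G" using good G by (simp add: good_opt_def opts_dead)
  then obtain H' where H': "H' |\<in>| right_opts H" "G' \<succeq> H'"
    using game_ge_optD[OF G H] eq by (auto simp: game_eq_def)
  then obtain G'' where G'': "G'' |\<in>| right_opts G" "H' \<succeq> G''"
    using game_ge_optD[OF H G] eq by (auto simp: game_eq_def)
  have "G' \<succeq> G''" using H' G'' game_ge_trans by blast
  then have "G'' \<succeq> G'"
    using good G'' G by (auto simp: good_opt_def game_gt_def game_eq_def opts_dead)
  then have "H' \<succeq> G'" using G'' game_ge_trans by blast
  then show ?thesis using H' by (auto simp: game_eq_def)
qed

text \<open>The inductive step of \<open>factorisations_agree\<close>. The premise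
  \<open>unique\<close> is the induction hypothesis for the sums that arise when one summand is
  replaced by primes and the race drops.\<close>

lemma common_atom:
  assumes As: "\<forall>A\<in>#As. is_atom A" and Bs: "\<forall>B\<in>#Bs. is_atom B"
    and eq: "\<Sum>\<^sub># As \<approx> \<Sum>\<^sub># Bs" and "As \<noteq> {#}"
    and S: "\<And>A A'. A \<in># As \<Longrightarrow> \<not> is_prime A \<Longrightarrow> good_opt A' A \<Longrightarrow> racing_opt A' A \<Longrightarrow>
      prime_factorisable A'"
    and unique: "\<And>a Ps Cs. a \<in># As \<Longrightarrow> \<forall>P\<in>#Ps. is_atom P \<and> is_prime P \<Longrightarrow> \<forall>C\<in>#Cs. is_atom C \<Longrightarrow>
      race (\<Sum>\<^sub># (As - {#a#} + Ps)) < race (\<Sum>\<^sub># As) \<Longrightarrow>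
      \<Sum>\<^sub># (As - {#a#} + Ps) \<approx> \<Sum>\<^sub># Cs \<Longrightarrow> rel_mset (\<approx>) (As - {#a#} + Ps) Cs"
  shows "\<exists>a\<in>#As. \<exists>b\<in>#Bs. a \<approx> b"
proof -
  have dAs: "left_dead_end (\<Sum>\<^sub># As)" and dBs: "left_dead_end (\<Sum>\<^sub># Bs)"
    using As Bs by (simp_all add: left_dead_end_sum_atoms)
  have prime: ?thesis if p: "is_prime p" "p \<in># As" for p
  proof -
    have "divides p (\<Sum>\<^sub># Bs)"
      using divides_cong[OF divides_sum_mset eq] p As is_atom_dead by blast
    then obtain b where "b \<in># Bs" "b \<approx> p" using is_prime_dvd_sum_mset p Bs by blast
    then show ?thesis using p game_eq_sym by blast
  qed
  have "\<Sum>\<^sub># As \<noteq> 0"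
    using As \<open>As \<noteq> {#}\<close> by (cases As) (auto simp: game_plus_eq_0_iff)
  then obtain G' where G': "good_opt G' (\<Sum>\<^sub># As)" "racing_opt G' (\<Sum>\<^sub># As)"
    using ex_good_racing_opt dAs by blast
  have "G' |\<in>| right_opts (\<Sum>\<^sub># As)"
    using G' dAs by (simp add: good_opt_def opts_dead)
  then obtain a a' where a: "a \<in># As" "a' |\<in>| right_opts a"
      "G' = a' + \<Sum>\<^sub># (As - {#a#})"
    using right_opts_sum_mset by blast
  have As_a: "\<Sum>\<^sub># As = a + \<Sum>\<^sub># (As - {#a#})"
    using a(1) by (rule sum_mset.remove)
  have da: "left_dead_end a" "left_dead_end (\<Sum>\<^sub># (As - {#a#}))"
    using a(1) As by (auto intro: is_atom_dead intro!: left_dead_end_sum_atoms dest: in_diffD)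
  then have gr: "good_opt a' a" "racing_opt a' a"
    using good_racing_opt_plus[OF da a(2)] G' unfolding As_a a(3) by blast+
  obtain H' where "H' |\<in>| right_opts (\<Sum>\<^sub># Bs)" and H': "G' \<approx> H'"
    using good_opt_matched[OF dAs dBs eq G'(1)] by blast
  then obtain b b' where b: "b \<in># Bs" "b' |\<in>| right_opts b"
      "H' = b' + \<Sum>\<^sub># (Bs - {#b#})"
    using right_opts_sum_mset by blast
  have db': "left_dead_end b'" using b Bs is_atom_dead left_dead_end_right_opt by blast
  show ?thesis
  proof (cases "is_prime a")
    case True
    then show ?thesis using prime a by blast
  next
    case False
    then have "prime_factorisable a'" using S a gr by blast
    then obtain Ps where Ps: "is_factorisation Ps a'" "\<forall>P\<in>#Ps. is_prime P"
      by (auto simp: prime_factorisable_def)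
    \<comment> \<open>Nothing is known about \<open>b'\<close>, so its factorisation is arbitrary;
      \<open>unique\<close> allows any atoms on the right.\<close>
    obtain Cs where Cs: "is_factorisation Cs b'" using ex_factorisation db' by blast
    have G'_Ps: "G' \<approx> \<Sum>\<^sub># (As - {#a#} + Ps)"
      using Ps(1) a(3) game_eq_plus[OF _ game_eq_refl] by (simp add: is_factorisation_def add.commute)
    have H'_Cs: "H' \<approx> \<Sum>\<^sub># (Bs - {#b#} + Cs)"
      using Cs b(3) game_eq_plus[OF _ game_eq_refl] by (simp add: is_factorisation_def add.commute)
    have "left_dead_end G'" using \<open>G' |\<in>| right_opts (\<Sum>\<^sub># As)\<close> dAs left_dead_end_right_opt by blast
    moreover have "left_dead_end (\<Sum>\<^sub># (As - {#a#} + Ps))"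
      using da(2) Ps by (simp add: left_dead_end_sum_atoms is_factorisation_def)
    ultimately have "race (\<Sum>\<^sub># (As - {#a#} + Ps)) < race (\<Sum>\<^sub># As)"
      using race_cong[OF _ _ G'_Ps] G'(2) by (simp add: racing_opt_def)
    moreover have "\<Sum>\<^sub># (As - {#a#} + Ps) \<approx> \<Sum>\<^sub># (Bs - {#b#} + Cs)"
      using G'_Ps H'_Cs H' game_eq_sym game_eq_trans by blast
    ultimately have rel: "rel_mset (\<approx>) (As - {#a#} + Ps) (Bs - {#b#} + Cs)"
      using Ps Cs Bs a
      by (intro unique) (auto simp: is_factorisation_def dest: in_diffD)
    show ?thesis
    proof (cases "Bs = {#b#}")
      \<comment> \<open>With no further atom beside \<open>b\<close> to trace, the left sum itself
        equals the atom \<open>b\<close>, which is therefore one of its summands.\<close>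
      case True
      then show ?thesis
        using atom_sum_msetD[of b As] eq As Bs game_eq_sym by auto
    next
      case False
      then have "Bs - {#b#} \<noteq> {#}" using b(1) by (metis insert_DiffM)
      then obtain c where c: "c \<in># Bs - {#b#}" by blast
      then obtain Ds where "Bs - {#b#} + Cs = add_mset c Ds"
        by (metis mset_add union_iff)
      then have "rel_mset (\<approx>) (As - {#a#} + Ps) (add_mset c Ds)" using rel by simp
      \<comment> \<open>\<open>x\<close> is the partner of \<open>c\<close> in the matching: an
        untouched summand, or one of the primes from \<open>a'\<close>.\<close>
      from msed_rel_invR[OF this] obtain x Es
        where x_Es: "As - {#a#} + Ps = add_mset x Es" and "x \<approx> c" by blast
      then have x: "x \<in># As - {#a#} + Ps" "x \<approx> c"
        unfolding x_Es by simp_all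
      show ?thesis
      proof (cases "x \<in># As - {#a#}")
        case True
        then show ?thesis using x c by (meson in_diffD)
      next
        case False
        then have "is_prime x" using x Ps by auto
        moreover have "divides x (\<Sum>\<^sub># Bs)"
        proof -
          have "left_dead_end (\<Sum>\<^sub># (Bs - {#c#}))"
            using Bs by (auto intro!: left_dead_end_sum_atoms dest: in_diffD)
          moreover have "\<Sum>\<^sub># Bs = c + \<Sum>\<^sub># (Bs - {#c#})"
            using c by (intro sum_mset.remove) (rule in_diffD)
          ultimately show ?thesis
            using x(2) game_eq_plus[OF game_eq_sym game_eq_refl] by (auto simp: divides_def)
        qed
        ultimately obtain a2 where "a2 \<in># As" "a2 \<approx> x"
          using is_prime_dvd_sum_mset As divides_cong[OF _ game_eq_sym[OF eq]] by blast
        then show ?thesis using x c game_eq_trans by (meson in_diffD)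
      qed
    qed
  qed
qed

lemma factorisations_agree:
  assumes S: "\<And>A A'. A \<in> S \<Longrightarrow> good_opt A' A \<Longrightarrow> racing_opt A' A \<Longrightarrow> prime_factorisable A'"
  shows "\<forall>A\<in>#As. is_atom A \<and> (A \<in> S \<or> is_prime A) \<Longrightarrow> \<forall>B\<in>#Bs. is_atom B \<Longrightarrow>
    \<Sum>\<^sub># As \<approx> \<Sum>\<^sub># Bs \<Longrightarrow> rel_mset (\<approx>) As Bs"
proof (induction "race (\<Sum>\<^sub># As)" arbitrary: As Bs rule: less_induct)
  case less
  show ?case
  proof (cases "As = {#}")
    case True
    have "left_dead_end (\<Sum>\<^sub># Bs)"
      using less.prems by (simp add: left_dead_end_sum_atoms)
    then have "\<Sum>\<^sub># Bs = 0" using True less.prems(3) dead_eq_zero_iff game_eq_sym by auto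
    then have "Bs = {#}"
      using less.prems(2) by (cases Bs) (auto simp: game_plus_eq_0_iff)
    then show ?thesis using True by (simp add: rel_mset_Zero)
  next
    case False
    have "\<exists>a\<in>#As. \<exists>b\<in>#Bs. a \<approx> b"
    proof (rule common_atom)
      fix a Ps Cs
      assume "\<forall>P\<in>#Ps. is_atom P \<and> is_prime P" "\<forall>C\<in>#Cs. is_atom C"
        "race (\<Sum>\<^sub># (As - {#a#} + Ps)) < race (\<Sum>\<^sub># As)" "\<Sum>\<^sub># (As - {#a#} + Ps) \<approx> \<Sum>\<^sub># Cs"
      then show "rel_mset (\<approx>) (As - {#a#} + Ps) Cs"
        using less.prems(1) by (intro less.hyps) (auto dest: in_diffD)
    qed (use less.prems False S in auto)
    then obtain a b As' Bs' where ab: "a \<approx> b" and As: "As = add_mset a As'" and Bs: "Bs = add_mset b Bs'"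
      by (metis mset_add)
    have dead: "left_dead_end a" "left_dead_end b" "left_dead_end (\<Sum>\<^sub># As')" "left_dead_end (\<Sum>\<^sub># Bs')"
      using less.prems As Bs by (simp_all add: is_atom_dead left_dead_end_sum_atoms)
    have "\<Sum>\<^sub># As' + a \<approx> \<Sum>\<^sub># Bs' + b"
      using less.prems(3) As Bs by (simp add: add.commute)
    also have "\<Sum>\<^sub># Bs' + b \<approx> \<Sum>\<^sub># Bs' + a"
      using ab by (simp add: game_eq_plus game_eq_sym)
    \<comment> \<open>Once \<open>b\<close> is exchanged for the equal \<open>a\<close>, the common
      atom cancels, and the induction hypothesis matches what is left.\<close>
    finally have "\<Sum>\<^sub># As' \<approx> \<Sum>\<^sub># Bs'" using game_eq_cancel dead by blast
    moreover have "race a \<noteq> 0"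
      using less.prems(1) As by (auto simp: race_eq_0_iff)
    then have "race (\<Sum>\<^sub># As') < race (\<Sum>\<^sub># As)" using As by (simp add: race_plus)
    ultimately have "rel_mset (\<approx>) As' Bs'" using less As Bs by auto
    then show ?thesis using ab As Bs rel_mset_Plus by auto
  qed
qed

theorem mainTheorem18:
  fixes S :: "game set"
  assumes "\<forall>A\<in>S. is_atom A"
    and "\<forall>A\<in>S. \<forall>A'. good_opt A' A \<and> racing_opt A' A \<longrightarrow> prime_factorisable A'"
  shows "\<forall>G. left_dead_end G \<longrightarrow> (\<exists>As. set_mset As \<subseteq> S \<and> G \<approx> \<Sum>\<^sub># As) \<longrightarrow>
    uniquely_factorisable G"
proof (intro allI impI)
  fix G assume "\<exists>As. set_mset As \<subseteq> S \<and> G \<approx> \<Sum>\<^sub># As"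
  then obtain As where As: "set_mset As \<subseteq> S" "G \<approx> \<Sum>\<^sub># As" by blast
  \<comment> \<open>The given sum over \<open>S\<close> is the reference factorisation, and its
    competitors consist of arbitrary atoms.\<close>
  have "rel_mset (\<approx>) As Bs" if "is_factorisation Bs G" for Bs
  proof (rule factorisations_agree[where S = S])
    show "\<Sum>\<^sub># As \<approx> \<Sum>\<^sub># Bs"
      using As that game_eq_sym game_eq_trans unfolding is_factorisation_def by blast
  qed (use assms As that in \<open>auto simp: is_factorisation_def\<close>)
  moreover have "is_factorisation As G" using As assms by (auto simp: is_factorisation_def)
  ultimately show "uniquely_factorisable G" unfolding uniquely_factorisable_def by blast
qed

end
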